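(* Let $(P,P')$ be a pair of $i$-swapped standard parabolic subgroups of $\mathrm{SL}_n(\mathbb{C})$. The reflection functor $\Phi_i=\Phi_i(P,P')$ (for a fixed torsion scalar $\tau_i\in\mathbb{C}^*$) is $\mathrm{SL}_n$-equivariant: for all $g\in\mathrm{SL}_n$ and all $[B]\in\operatorname{Spec}\big(\mathbb{C}[m_{P,\mathrm{inj}}^{-1}(0)]^{\mathrm{SL}_{\mathbf v}}\big)$, $$\Phi_i(g\cdot[B])=g\cdot\Phi_i([B]).$$
   Context: Everything is over $\mathbb{C}$. Parabolics. Let $0=d_0<d_1<\dots<d_k=n$ and $s_a:=d_a-d_{a-1}$; $P$ is the standard (block upper triangular) parabolic of $\mathrm{SL}_n$ with ordered block sizes $(s_1,\dots,s_k)$. For $1\le i\le k-1$, the pair $(P,P')$ is $i$-swapped if $P'$ is the standard parabolic obtained by swapping the $i$th and $(i+1)$st block sizes; its partial sums are $d_i'=d_{i-1}+d_{i+1}-d_i$, $d_a'=d_a$ for $a\neq i$. Quiver data. To $P$ attach $T^*V=\bigoplus_{a=1}^{k-1}\big(\operatorname{Hom}(\mathbb{C}^{d_a},\mathbb{C}^{d_{a+1}})\oplus\operatorname{Hom}(\mathbb{C}^{d_{a+1}},\mathbb{C}^{d_a})\big)$ with elements $B=(\alpha_a,\beta_a)_{a=1}^{k-1}$, and gauge group $\mathrm{SL}_{\mathbf v}=\prod_{a=1}^{k-1}\mathrm{SL}_{d_a}$ acting by $\alpha_a\mapsto g_{a+1}\alpha_ag_a^{-1}$, $\beta_a\mapsto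 g_a\beta_ag_{a+1}^{-1}$ (with $g_k=1$). Convention: $\mathbb{C}^{d_0}=0$, $\alpha_0=\beta_0=0$. Let $m_{P,\mathrm{inj}}^{-1}(0)$ be the variety of those $B$ with every $\alpha_a$ injective and such that for each $1\le a\le k-1$ there is a scalar $\lambda_a(B)$ with $\alpha_{a-1}\beta_{a-1}-\beta_a\alpha_a=\lambda_a(B)\,\mathrm{Id}_{d_a}$. It is smooth with free $\mathrm{SL}_{\mathbf v}$-action, and its geometric quotient is isomorphic to $T^*(\mathrm{SL}_n/[P,P])$; hence $\overline{T^*(\mathrm{SL}_n/[P,P])}^{\mathrm{aff}}\cong\mathcal{M}_P:=\operatorname{Spec}\big(\mathbb{C}[m_{P,\mathrm{inj}}^{-1}(0)]^{\mathrm{SL}_{\mathbf v}}\big)$, where $\overline{X}^{\mathrm{aff}}=\operatorname{Spec}\Gamma(X,\mathcal{O}_X)$. Write $[B]$ for the image of $B$ in $\mathcal{M}_P$. $\mathrm{SL}_n$-action. $g\cdot[\alpha_1,\beta_1,\dots,\alpha_{k-1},\beta_{k-1}]:=[\alpha_1,\beta_1,\dots,g\alpha_{k-1},\beta_{k-1}g^{-1}]$; this induces an action on $\mathcal{M}_P$ (and likewise on $\mathcal{M}_{P'}$). Zippers. Put $\operatorname{out}_i(B)=\begin{pmatrix}\beta_{i-1}\\ \alpha_i\end{pmatrix}:\mathbb{C}^{d_i}\to\mathbb{C}^{d_{i-1}}\oplus\mathbb{C}^{d_{i+1}}$ and $\operatorname{in}_i(B)=\begin{pmatrix}-\alpha_{i-1}&\beta_i\end{pmatrix}:\mathbb{C}^{d_{i-1}}\oplus\mathbb{C}^{d_{i+1}}\to\mathbb{C}^{d_i}$.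 Let $\Lambda^{\mathrm{surj}}_{P,i}\subset m_{P,\mathrm{inj}}^{-1}(0)$ be the open set where $\operatorname{in}_i(B)$ is surjective. For $\tau\in\mathbb{C}^*$, let $Z_i^{\tau}(P,P')\subset\Lambda^{\mathrm{surj}}_{P,i}\times m_{P',\mathrm{inj}}^{-1}(0)$ be the set of pairs $(B,B')$ such that: (C1) $\alpha_a=\alpha_a'$, $\beta_a=\beta_a'$ for $a\notin\{i-1,i\}$; (C2) $0\to\mathbb{C}^{d_i'}\xrightarrow{\operatorname{out}_i(B')}\mathbb{C}^{d_{i-1}}\oplus\mathbb{C}^{d_{i+1}}\xrightarrow{\operatorname{in}_i(B)}\mathbb{C}^{d_i}\to0$ is exact and has torsion $\tau$, i.e. with fixed standard volume elements $\mathrm{vol}_a\in\bigwedge^a\mathbb{C}^a$, $\operatorname{out}_i(B')(\mathrm{vol}_{d_i'})\wedge\operatorname{in}_i(B)^{-1}(\mathrm{vol}_{d_i})=\tau\,\mathrm{vol}_{d_{i-1}}\wedge\mathrm{vol}_{d_{i+1}}$, where $\operatorname{in}_i(B)^{-1}(\mathrm{vol}_{d_i})$ is any exterior lift along $\operatorname{in}_i(B)$; (C3) $\operatorname{out}_i(B')\operatorname{in}_i(B')=\operatorname{out}_i(B)\operatorname{in}_i(B)+\lambda_i(B)\,\mathrm{Id}$. Reflection functor. If $s_i\le s_{i+1}$, $\Phi_i(P,P')=\Phi_i^{\tau}(P,P'):\mathcal{M}_P\to\mathcal{M}_{P'}$ is the unique isomorphism with $\Phi_i([B])=[B']$ for all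 $(B,B')\in Z_i^{\tau}(P,P')$; if $s_i>s_{i+1}$, $\Phi_i^{\tau}(P,P'):=\Phi_i^{\tau}(P',P)^{-1}$. *)

theory Defs
  imports
    "HOL-Library.FuncSet"
    "HOL-Algebra.QuotRing"
    "Jordan_Normal_Form.Determinant"
    "Jordan_Normal_Form.Matrix_Kernel"
    "Jordan_Normal_Form.Gauss_Jordan_Elimination"
begin

definition SL :: "nat \<Rightarrow> complex mat set" where
  "SL n = {g \<in> carrier_mat n n. det g = 1}"

abbreviation minv :: "complex mat \<Rightarrow> complex mat" where
  "minv g \<equiv> the (mat_inverse g)"

definition inj_mat :: "complex mat \<Rightarrow> bool" where
  "inj_mat A \<longleftrightarrow> inj_on (\<lambda>v. A *\<^sub>v v) (carrier_vec (dim_col A))"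

definition range_mat :: "complex mat \<Rightarrow> complex vec set" where
  "range_mat A = (\<lambda>v. A *\<^sub>v v) ` carrier_vec (dim_col A)"

definition surj_mat :: "complex mat \<Rightarrow> bool" where
  "surj_mat A \<longleftrightarrow> range_mat A = carrier_vec (dim_row A)"

text \<open>The block row \<open>(A B)\<close>; block columns are the library's \<open>A @\<^sub>r B\<close>.\<close>
definition append_cols :: "complex mat \<Rightarrow> complex mat \<Rightarrow> complex mat" (infixr \<open>@\<^sub>h\<close> 65) where
  "A @\<^sub>h B = four_block_mat A B (0\<^sub>m 0 (dim_col A)) (0\<^sub>m 0 (dim_col B))"

text \<open>A standard parabolic of \<open>SL\<^sub>n\<close> is represented by the list \<open>s\<close> of its ordered block sizes,
  which determines it and is determined by it. Lists are indexed from \<open>0\<close>, so the block size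
  \<open>s\<^sub>a\<close> is \<open>s ! (a - 1)\<close>.\<close>
definition standard_parabolic :: "nat \<Rightarrow> nat list \<Rightarrow> bool" where
  "standard_parabolic n s \<longleftrightarrow> (\<forall>x\<in>set s. 0 < x) \<and> sum_list s = n"

definition dm :: "nat list \<Rightarrow> nat \<Rightarrow> nat" where
  "dm s a = sum_list (take a s)"

definition i_swapped :: "nat \<Rightarrow> nat list \<Rightarrow> nat list \<Rightarrow> bool" where
  "i_swapped i s s' \<longleftrightarrow> 1 \<le> i \<and> i < length s \<and> s' = s[i - 1 := s ! i, i := s ! (i - 1)]"

text \<open>\<open>B a = (\<alpha>\<^sub>a, \<beta>\<^sub>a)\<close> for \<open>0 \<le> a < k\<close>. Since \<open>dm s 0 = 0\<close>, the component at \<open>a = 0\<close> can only be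
  the pair of empty matrices; this is the convention \<open>\<alpha>\<^sub>0 = \<beta>\<^sub>0 = 0\<close>.\<close>
type_synonym rep = "nat \<Rightarrow> complex mat \<times> complex mat"

abbreviation \<alpha> :: "rep \<Rightarrow> nat \<Rightarrow> complex mat" where "\<alpha> B a \<equiv> fst (B a)"
abbreviation \<beta> :: "rep \<Rightarrow> nat \<Rightarrow> complex mat" where "\<beta> B a \<equiv> snd (B a)"

definition cotangent :: "nat list \<Rightarrow> rep set" where
  "cotangent s = (\<Pi>\<^sub>E a\<in>{..<length s}.
     carrier_mat (dm s (a + 1)) (dm s a) \<times> carrier_mat (dm s a) (dm s (a + 1)))"

definition gauge_group :: "nat list \<Rightarrow> (nat \<Rightarrow> complex mat) set" where
  "gauge_group s = {g \<in> (\<Pi>\<^sub>E a\<in>{..length s}. SL (dm s a)).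
     g (length s) = 1\<^sub>m (dm s (length s))}"

definition gauge_act :: "nat list \<Rightarrow> (nat \<Rightarrow> complex mat) \<Rightarrow> rep \<Rightarrow> rep" where
  "gauge_act s g B = (\<lambda>a\<in>{..<length s}.
     (g (a + 1) * \<alpha> B a * minv (g a), g a * \<beta> B a * minv (g (a + 1))))"

definition moment_eq :: "nat list \<Rightarrow> rep \<Rightarrow> nat \<Rightarrow> complex \<Rightarrow> bool" where
  "moment_eq s B a l \<longleftrightarrow>
     \<alpha> B (a - 1) * \<beta> B (a - 1) - \<beta> B a * \<alpha> B a = l \<cdot>\<^sub>m 1\<^sub>m (dm s a)"

definition X :: "nat list \<Rightarrow> rep set" where
  "X s = {B \<in> cotangent s. \<forall>a. 1 \<le> a \<and> a < length s \<longrightarrow>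
     inj_mat (\<alpha> B a) \<and> (\<exists>l. moment_eq s B a l)}"

text \<open>For \<open>1 \<le> a < k\<close> one has \<open>dm s a > 0\<close>, so the scalar is unique.\<close>
definition moment_scalar :: "nat list \<Rightarrow> rep \<Rightarrow> nat \<Rightarrow> complex" where
  "moment_scalar s B a = (THE l. moment_eq s B a l)"

definition sl_act_rep :: "nat list \<Rightarrow> complex mat \<Rightarrow> rep \<Rightarrow> rep" where
  "sl_act_rep s g B =
     B(length s - 1 := (g * \<alpha> B (length s - 1), \<beta> B (length s - 1) * minv g))"

inductive_set poly_fun :: "nat list \<Rightarrow> (rep \<Rightarrow> complex) set" for s :: "nat list" where
  const: "(\<lambda>B. c) \<in> poly_fun s"
| alpha: "\<lbrakk>a < length s; r < dm s (a + 1); c < dm s a\<rbrakk> \<Longrightarrow> (\<lambda>B. \<alpha> B a $$ (r, c)) \<in> poly_fun s"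
| beta: "\<lbrakk>a < length s; r < dm s a; c < dm s (a + 1)\<rbrakk> \<Longrightarrow> (\<lambda>B. \<beta> B a $$ (r, c)) \<in> poly_fun s"
| add: "\<lbrakk>p \<in> poly_fun s; q \<in> poly_fun s\<rbrakk> \<Longrightarrow> (\<lambda>B. p B + q B) \<in> poly_fun s"
| mult: "\<lbrakk>p \<in> poly_fun s; q \<in> poly_fun s\<rbrakk> \<Longrightarrow> (\<lambda>B. p B * q B) \<in> poly_fun s"

text \<open>\<open>X s\<close> is locally closed in the affine space \<open>cotangent s\<close>, and in general neither closed nor
  affine. A regular function on it is locally a quotient of polynomials; basic open sets
  \<open>q \<noteq> 0\<close> suffice as neighbourhoods.\<close>
definition regular_fun :: "nat list \<Rightarrow> (rep \<Rightarrow> complex) \<Rightarrow> bool" where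
  "regular_fun s f \<longleftrightarrow> (\<forall>B\<in>X s. \<exists>p\<in>poly_fun s. \<exists>q\<in>poly_fun s.
     q B \<noteq> 0 \<and> (\<forall>C\<in>X s. q C \<noteq> 0 \<longrightarrow> f C = p C / q C))"

definition const_fun :: "nat list \<Rightarrow> complex \<Rightarrow> rep \<Rightarrow> complex" where
  "const_fun s c = (\<lambda>B\<in>X s. c)"

definition inv_ring :: "nat list \<Rightarrow> (rep \<Rightarrow> complex) ring" where
  "inv_ring s = \<lparr>
     carrier = {f \<in> extensional (X s). regular_fun s f \<and>
       (\<forall>g\<in>gauge_group s. \<forall>B\<in>X s. f (gauge_act s g B) = f B)},
     mult = (\<lambda>f h. \<lambda>B\<in>X s. f B * h B),
     one = const_fun s 1,
     zero = const_fun s 0,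
     add = (\<lambda>f h. \<lambda>B\<in>X s. f B + h B)\<rparr>"

definition Spec :: "('a, 'm) ring_scheme \<Rightarrow> 'a set set" where
  "Spec R = {p. primeideal p R}"

definition Spec_map :: "('a, 'm) ring_scheme \<Rightarrow> ('a \<Rightarrow> 'b) \<Rightarrow> 'b set \<Rightarrow> 'a set" where
  "Spec_map R h p = {r \<in> carrier R. h r \<in> p}"

definition M :: "nat list \<Rightarrow> (rep \<Rightarrow> complex) set set" where
  "M s = Spec (inv_ring s)"

text \<open>\<open>[B]\<close>, as the kernel of evaluation at \<open>B\<close>.\<close>
definition pt :: "nat list \<Rightarrow> rep \<Rightarrow> (rep \<Rightarrow> complex) set" where
  "pt s B = {f \<in> carrier (inv_ring s). f B = 0}"

text \<open>The automorphism of \<open>M s\<close> whose comorphism is \<open>f \<mapsto> (B \<mapsto> f (g \<cdot> B))\<close>; in particular it sends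
  \<open>[B]\<close> to \<open>[g \<cdot> B]\<close>.\<close>
definition sl_act :: "nat list \<Rightarrow> complex mat \<Rightarrow> (rep \<Rightarrow> complex) set \<Rightarrow> (rep \<Rightarrow> complex) set" where
  "sl_act s g = Spec_map (inv_ring s) (\<lambda>f. \<lambda>B\<in>X s. f (sl_act_rep s g B))"

text \<open>Isomorphisms of affine schemes over the complex numbers are those induced by isomorphisms
  of algebras in the opposite direction. The rings here consist of functions on \<open>X s\<close>, so \<open>\<Phi>\<close> as
  a map on prime ideals determines the algebra isomorphism \<open>h\<close>: the value of \<open>h f\<close> at \<open>B\<close> is the
  only scalar \<open>c\<close> with \<open>f - c \<in> \<Phi> (pt s B)\<close>. Hence nothing is lost by working with \<open>\<Phi>\<close> alone.\<close>
definition scheme_iso ::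
    "nat list \<Rightarrow> nat list \<Rightarrow> ((rep \<Rightarrow> complex) set \<Rightarrow> (rep \<Rightarrow> complex) set) \<Rightarrow> bool" where
  "scheme_iso s s' \<Phi> \<longleftrightarrow> (\<exists>h \<in> ring_iso (inv_ring s') (inv_ring s).
     (\<forall>c. h (const_fun s' c) = const_fun s c) \<and>
     \<Phi> = restrict (Spec_map (inv_ring s') h) (M s))"

definition out_mat :: "nat \<Rightarrow> rep \<Rightarrow> complex mat" where
  "out_mat i B = \<beta> B (i - 1) @\<^sub>r \<alpha> B i"

definition in_mat :: "nat \<Rightarrow> rep \<Rightarrow> complex mat" where
  "in_mat i B = (- \<alpha> B (i - 1)) @\<^sub>h \<beta> B i"

definition surj_locus :: "nat \<Rightarrow> nat list \<Rightarrow> rep set" where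
  "surj_locus i s = {B \<in> X s. surj_mat (in_mat i B)}"

definition short_exact :: "complex mat \<Rightarrow> complex mat \<Rightarrow> bool" where
  "short_exact U T \<longleftrightarrow> inj_mat U \<and> range_mat U = mat_kernel T \<and> surj_mat T"

text \<open>With \<open>N = dim_col T\<close> and \<open>m = dim_row T > 0\<close>, a list of \<open>N \<times> m\<close> matrices stands for the element
  of the \<open>m\<close>-th exterior power of the \<open>N\<close>-dimensional space that is the sum of the wedge products
  of their columns; every element is of this form. Its image under \<open>T\<close> is the standard volume
  element iff the determinants of the products \<open>T L\<close> sum to \<open>1\<close>. Likewise the wedge product of the
  columns of \<open>U\<close> followed by those of \<open>L\<close> is \<open>det (U @\<^sub>h L)\<close> times the standard volume element.\<close>
definition vol_lift :: "complex mat \<Rightarrow> complex mat list \<Rightarrow> bool" where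
  "vol_lift T Ls \<longleftrightarrow> set Ls \<subseteq> carrier_mat (dim_col T) (dim_row T) \<and> (\<Sum>L\<leftarrow>Ls. det (T * L)) = 1"

definition has_torsion :: "complex mat \<Rightarrow> complex mat \<Rightarrow> complex \<Rightarrow> bool" where
  "has_torsion U T \<tau> \<longleftrightarrow> (\<forall>Ls. vol_lift T Ls \<longrightarrow> (\<Sum>L\<leftarrow>Ls. det (U @\<^sub>h L)) = \<tau>)"

definition zipper :: "nat \<Rightarrow> complex \<Rightarrow> nat list \<Rightarrow> nat list \<Rightarrow> (rep \<times> rep) set" where
  "zipper i \<tau> s s' = {(B, B'). B \<in> surj_locus i s \<and> B' \<in> X s' \<and>
     (\<forall>a<length s. a \<notin> {i - 1, i} \<longrightarrow> \<alpha> B a = \<alpha> B' a \<and> \<beta> B a = \<beta> B' a) \<and>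
     short_exact (out_mat i B') (in_mat i B) \<and>
     has_torsion (out_mat i B') (in_mat i B) \<tau> \<and>
     out_mat i B' * in_mat i B' =
       out_mat i B * in_mat i B + moment_scalar s B i \<cdot>\<^sub>m 1\<^sub>m (dm s (i - 1) + dm s (i + 1))}"

definition zipper_iso :: "nat \<Rightarrow> complex \<Rightarrow> nat list \<Rightarrow> nat list \<Rightarrow>
    ((rep \<Rightarrow> complex) set \<Rightarrow> (rep \<Rightarrow> complex) set) \<Rightarrow> bool" where
  "zipper_iso i \<tau> s s' \<Phi> \<longleftrightarrow> scheme_iso s s' \<Phi> \<and>
     (\<forall>(B, B') \<in> zipper i \<tau> s s'. \<Phi> (pt s B) = pt s' B')"

definition is_unique_zipper_iso :: "nat \<Rightarrow> complex \<Rightarrow> nat list \<Rightarrow> nat list \<Rightarrow>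
    ((rep \<Rightarrow> complex) set \<Rightarrow> (rep \<Rightarrow> complex) set) \<Rightarrow> bool" where
  "is_unique_zipper_iso i \<tau> s s' \<Phi> \<longleftrightarrow>
     zipper_iso i \<tau> s s' \<Phi> \<and> (\<forall>\<Psi>. zipper_iso i \<tau> s s' \<Psi> \<longrightarrow> \<Psi> = \<Phi>)"

text \<open>\<open>\<Phi>\<close> is the reflection functor from \<open>M s\<close> to \<open>M s'\<close>. For \<open>s\<^sub>i > s\<^sub>i\<^sub>+\<^sub>1\<close> it is the inverse of
  the one in the opposite direction.\<close>
definition is_reflection_functor :: "nat \<Rightarrow> complex \<Rightarrow> nat list \<Rightarrow> nat list \<Rightarrow>
    ((rep \<Rightarrow> complex) set \<Rightarrow> (rep \<Rightarrow> complex) set) \<Rightarrow> bool" where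
  "is_reflection_functor i \<tau> s s' \<Phi> \<longleftrightarrow>
     (if s ! (i - 1) \<le> s ! i then is_unique_zipper_iso i \<tau> s s' \<Phi>
      else \<exists>\<Psi>. is_unique_zipper_iso i \<tau> s' s \<Psi> \<and> \<Phi> = restrict (inv_into (M s') \<Psi>) (M s))"

end

theory Submission
  imports Defs
begin

text \<open>
  Equivariance is a consequence of uniqueness. Let \<open>\<Phi>\<close> be the unique isomorphism that sends
  \<open>[B]\<close> to \<open>[B']\<close> for every pair \<open>(B, B')\<close> of the zipper, and let \<open>g\<close> lie in \<open>SL\<^sub>n\<close>. The zipper
  is stable under the simultaneous action \<open>(B, B') \<mapsto> (gB, gB')\<close> (\<open>zipper_sl_act_rep\<close>). So the
  conjugate \<open>g\<inverse> \<circ> \<Phi> \<circ> g\<close> also sends \<open>[B]\<close> to \<open>[g\<inverse>gB'] = [B']\<close>, and it is an isomorphism of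
  schemes over the complex numbers (\<open>scheme_iso_conjugate\<close>). By uniqueness it equals \<open>\<Phi>\<close>, which is
  the claim. For \<open>s\<^sub>i > s\<^sub>i\<^sub>+\<^sub>1\<close> the reflection functor is the inverse of an equivariant bijection,
  hence equivariant.

  The zipper is stable because \<open>g\<close> only touches the last pair \<open>(\<alpha>\<^sub>k\<^sub>-\<^sub>1, \<beta>\<^sub>k\<^sub>-\<^sub>1)\<close>. All conditions at
  vertex \<open>i\<close> are expressed through \<open>in\<^sub>i\<close> and \<open>out\<^sub>i\<close>, and these become \<open>in\<^sub>i D\<inverse>\<close> and \<open>D out\<^sub>i\<close> with
  the same matrix \<open>D\<close> for \<open>B\<close> and \<open>B'\<close>: the identity if \<open>i < k - 1\<close>, and \<open>diag(1, g)\<close> if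
  \<open>i = k - 1\<close> (\<open>out_in_mat_sl_act_rep\<close>). In other words, the middle term of the short exact sequence
  undergoes a change of basis. Exactness is insensitive to it, the torsion is unchanged since
  \<open>det D = 1\<close>, and the equation between \<open>out\<^sub>i in\<^sub>i\<close> for \<open>B'\<close> and for \<open>B\<close> is conjugated by \<open>D\<close>, which
  fixes its scalar term.

  To conjugate \<open>\<Phi>\<close> one needs that \<open>g\<close> acts on \<open>M s\<close> at all. Its comorphism, composition with
  \<open>B \<mapsto> gB\<close>, has to map invariant regular functions to such functions: it does, because \<open>g\<close>
  acts linearly and commutes with the gauge group, whose last component is \<open>1\<close>.
\<close>

section \<open>Unimodular matrices and block matrices\<close>

lemma SL_minv:
  assumes "g \<in> SL n"
  shows "g \<in> carrier_mat n n" "minv g \<in> carrier_mat n n"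
    "g * minv g = 1\<^sub>m n" "minv g * g = 1\<^sub>m n" "minv g \<in> SL n"
proof -
  show g: "g \<in> carrier_mat n n" using assms by (auto simp: SL_def)
  have d: "det g = 1" using assms by (auto simp: SL_def)
  obtain h where h: "mat_inverse g = Some h"
    using mat_inverse(1)[OF g, of undefined] det_non_zero_imp_unit[OF g, of undefined] d
    by (cases "mat_inverse g") auto
  from mat_inverse(2)[OF g h] show m: "minv g \<in> carrier_mat n n"
    "g * minv g = 1\<^sub>m n" "minv g * g = 1\<^sub>m n" by (simp_all add: h)
  have "det (g * minv g) = det g * det (minv g)" using g m(1) by (rule det_mult)
  then show "minv g \<in> SL n" using m d by (simp add: SL_def)
qed

lemma minv_unique:
  assumes "g \<in> SL n" "h \<in> carrier_mat n n" "g * h = 1\<^sub>m n"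
  shows "minv g = h"
proof -
  note g = SL_minv[OF assms(1)]
  have "minv g = minv g * (g * h)" using g(2) by (simp add: assms(3))
  also have "\<dots> = minv g * g * h" using g(1,2) assms(2) by simp
  finally show ?thesis using g assms by simp
qed

lemma minv_minv: "g \<in> SL n \<Longrightarrow> minv (minv g) = g"
  by (rule minv_unique) (auto simp: SL_minv)

lemma one_in_SL: "1\<^sub>m n \<in> SL n"
  by (simp add: SL_def)

lemma minv_one: "minv (1\<^sub>m n) = 1\<^sub>m n"
  by (rule minv_unique[OF one_in_SL]) auto

lemma SL_cancel_left:
  assumes "g \<in> SL n" "A \<in> carrier_mat n m"
  shows "minv g * (g * A) = A" "g * (minv g * A) = A"
proof -
  note g = SL_minv[OF assms(1)]
  show "minv g * (g * A) = A"
    using assoc_mult_mat[OF g(2) g(1) assms(2)] g(4) assms(2) by simp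
  show "g * (minv g * A) = A"
    using assoc_mult_mat[OF g(1) g(2) assms(2)] g(3) assms(2) by simp
qed

lemma SL_cancel_right:
  assumes "g \<in> SL n" "A \<in> carrier_mat m n"
  shows "A * minv g * g = A" "A * g * minv g = A"
  using SL_minv[OF assms(1)] assms(2) by (simp_all add: assoc_mult_mat)

lemma SL_cancel_middle:
  assumes "g \<in> SL n" "A \<in> carrier_mat p n" "C \<in> carrier_mat n q"
  shows "(A * minv g) * (g * C) = A * C"
  using SL_minv[OF assms(1)] assms
  by (simp add: assoc_mult_mat[of A p n _ n _ q] SL_cancel_left)

lemma inj_mat_mult:
  assumes "A \<in> carrier_mat p m" "C \<in> carrier_mat m q" "inj_mat A" "inj_mat C"
  shows "inj_mat (A * C)"
proof (unfold inj_mat_def, rule inj_onI)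
  fix v w
  assume "v \<in> carrier_vec (dim_col (A * C))" "w \<in> carrier_vec (dim_col (A * C))"
    and e: "A * C *\<^sub>v v = A * C *\<^sub>v w"
  then have vw: "v \<in> carrier_vec q" "w \<in> carrier_vec q" using assms by auto
  then have "A *\<^sub>v (C *\<^sub>v v) = A *\<^sub>v (C *\<^sub>v w)"
    using e assoc_mult_mat_vec[OF assms(1,2)] by simp
  then have "C *\<^sub>v v = C *\<^sub>v w"
    using assms(1-3) vw unfolding inj_mat_def inj_on_def by auto
  then show "v = w" using assms(2,4) vw unfolding inj_mat_def inj_on_def by auto
qed

lemma inj_mat_left_inverse:
  assumes "A \<in> carrier_mat n m" "C \<in> carrier_mat m n" "C * A = 1\<^sub>m m"
  shows "inj_mat A"
proof (unfold inj_mat_def, rule inj_onI)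
  fix v w
  assume "v \<in> carrier_vec (dim_col A)" "w \<in> carrier_vec (dim_col A)"
    and e: "A *\<^sub>v v = A *\<^sub>v w"
  then have vw: "v \<in> carrier_vec m" "w \<in> carrier_vec m" using assms by auto
  have "C * A *\<^sub>v v = C * A *\<^sub>v w"
    using assoc_mult_mat_vec[OF assms(2,1)] e vw by simp
  then show "v = w" using assms vw by simp
qed

lemma inj_mat_SL: "g \<in> SL n \<Longrightarrow> inj_mat g"
  by (rule inj_mat_left_inverse[of g n n "minv g"]) (auto simp: SL_minv)

lemma carrier_append_cols:
  "A \<in> carrier_mat p m \<Longrightarrow> C \<in> carrier_mat p q \<Longrightarrow> A @\<^sub>h C \<in> carrier_mat p (m + q)"
  unfolding append_cols_def by auto

text \<open>The block row is padded by empty lower blocks, so the rule for products of block matrices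
  applies once \<open>D\<close> is padded in the same way.\<close>
lemma mult_append_cols:
  assumes "D \<in> carrier_mat r p" "A \<in> carrier_mat p m" "C \<in> carrier_mat p q"
  shows "D * (A @\<^sub>h C) = (D * A) @\<^sub>h (D * C)"
proof -
  have D: "D = four_block_mat D (0\<^sub>m r 0) (0\<^sub>m 0 p) (0\<^sub>m 0 0)"
    using assms(1) by (intro eq_matI) auto
  have "D * (A @\<^sub>h C) =
      four_block_mat D (0\<^sub>m r 0) (0\<^sub>m 0 p) (0\<^sub>m 0 0) * four_block_mat A C (0\<^sub>m 0 m) (0\<^sub>m 0 q)"
    using assms D by (simp add: append_cols_def)
  also have "\<dots> = four_block_mat (D * A) (D * C) (0\<^sub>m 0 m) (0\<^sub>m 0 q)"
    by (subst mult_four_block_mat[of _ r p _ 0 _ 0 _ _ m _ q]) (use assms in auto)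
  finally show ?thesis using assms by (simp add: append_cols_def)
qed

definition lower_block :: "nat \<Rightarrow> nat \<Rightarrow> complex mat \<Rightarrow> complex mat" where
  "lower_block p n g = four_block_mat (1\<^sub>m p) (0\<^sub>m p n) (0\<^sub>m n p) g"

lemma lower_block_carrier: "g \<in> carrier_mat n n \<Longrightarrow> lower_block p n g \<in> carrier_mat (p + n) (p + n)"
  by (simp add: lower_block_def)

lemma lower_block_mult:
  assumes "g \<in> carrier_mat n n" "h \<in> carrier_mat n n"
  shows "lower_block p n g * lower_block p n h = lower_block p n (g * h)"
  unfolding lower_block_def
  by (subst mult_four_block_mat[of _ p p _ n _ n _ _ p _ n]) (use assms in auto)

lemma lower_block_one: "lower_block p n (1\<^sub>m n) = 1\<^sub>m (p + n)"
  by (simp add: lower_block_def)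

lemma lower_block_det:
  assumes "g \<in> carrier_mat n n"
  shows "det (lower_block p n g) = det g"
  unfolding lower_block_def
  by (subst det_four_block_mat_lower_left_zero[of _ p _ n]) (use assms in auto)

lemma lower_block_SL: "g \<in> SL n \<Longrightarrow> lower_block p n g \<in> SL (p + n)"
  by (auto simp: SL_def lower_block_det lower_block_carrier)

lemma lower_block_minv:
  assumes "g \<in> SL n"
  shows "minv (lower_block p n g) = lower_block p n (minv g)"
  by (rule minv_unique[OF lower_block_SL[OF assms]])
    (use SL_minv[OF assms] in \<open>auto simp: lower_block_carrier lower_block_mult lower_block_one\<close>)

lemma lower_block_append_rows:
  assumes "g \<in> carrier_mat n n" "A \<in> carrier_mat p m" "C \<in> carrier_mat n m"
  shows "lower_block p n g * (A @\<^sub>r C) = A @\<^sub>r (g * C)"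
proof -
  have "lower_block p n g * (A @\<^sub>r C) =
      four_block_mat (1\<^sub>m p) (0\<^sub>m p n) (0\<^sub>m n p) g * four_block_mat A (0\<^sub>m p 0) C (0\<^sub>m n 0)"
    using assms by (simp add: append_rows_def lower_block_def)
  also have "\<dots> = four_block_mat A (0\<^sub>m p 0) (g * C) (0\<^sub>m n 0)"
    by (subst mult_four_block_mat[of _ p p _ n _ n _ _ m _ 0]) (use assms in auto)
  finally show ?thesis using assms by (simp add: append_rows_def)
qed

lemma append_cols_lower_block:
  assumes "g \<in> carrier_mat n n" "A \<in> carrier_mat m p" "C \<in> carrier_mat m n"
  shows "(A @\<^sub>h C) * lower_block p n g = A @\<^sub>h (C * g)"
proof -
  have "(A @\<^sub>h C) * lower_block p n g =
      four_block_mat A C (0\<^sub>m 0 p) (0\<^sub>m 0 n) * four_block_mat (1\<^sub>m p) (0\<^sub>m p n) (0\<^sub>m n p) g"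
    using assms by (simp add: append_cols_def lower_block_def)
  also have "\<dots> = four_block_mat A (C * g) (0\<^sub>m 0 p) (0\<^sub>m 0 n)"
    by (subst mult_four_block_mat[of _ m p _ n _ 0 _ _ p _ n]) (use assms in auto)
  finally show ?thesis using assms by (simp add: append_cols_def)
qed

section \<open>Exactness and torsion under a unimodular change of the middle term\<close>

lemma surj_mat_mult_SL:
  assumes "D \<in> SL N" "T \<in> carrier_mat m N" "surj_mat T"
  shows "surj_mat (T * minv D)"
proof -
  note D = SL_minv[OF assms(1)]
  have "v \<in> range_mat (T * minv D)" if v: "v \<in> carrier_vec m" for v
  proof -
    have "v \<in> (\<lambda>w. T *\<^sub>v w) ` carrier_vec N"
      using assms(2,3) v by (simp add: surj_mat_def range_mat_def)
    then obtain w where w: "w \<in> carrier_vec N" "T *\<^sub>v w = v" by blast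
    have "T * minv D *\<^sub>v (D *\<^sub>v w) = (T * minv D * D) *\<^sub>v w"
      using D assms(2) w by (subst assoc_mult_mat_vec[of _ m N _ N]) auto
    also have "\<dots> = v" using SL_cancel_right(1)[OF assms(1,2)] w by simp
    finally show ?thesis
      using D w by (auto simp: range_mat_def intro!: image_eqI[of _ _ "D *\<^sub>v w"])
  qed
  moreover have "range_mat (T * minv D) \<subseteq> carrier_vec m"
    using D assms(2) by (auto simp: range_mat_def)
  ultimately show ?thesis using assms(2) by (auto simp: surj_mat_def)
qed

text \<open>\<open>D\<close> maps the image of \<open>U\<close> onto the image of \<open>D U\<close> and the kernel of \<open>T\<close> onto the kernel of
  \<open>T D\<inverse>\<close>.\<close>
lemma short_exact_mult_SL:
  assumes "D \<in> SL N" "U \<in> carrier_mat N q" "T \<in> carrier_mat m N" "short_exact U T"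
  shows "short_exact (D * U) (T * minv D)"
proof -
  note D = SL_minv[OF assms(1)]
  have ex: "inj_mat U" "range_mat U = mat_kernel T" "surj_mat T"
    using assms(4) by (auto simp: short_exact_def)
  have act: "T * minv D *\<^sub>v v = T *\<^sub>v (minv D *\<^sub>v v)" if "v \<in> carrier_vec N" for v
    using D assms(3) that by (subst assoc_mult_mat_vec[of _ m N _ N]) auto
  have DU: "D * U *\<^sub>v u = D *\<^sub>v (U *\<^sub>v u)" if "u \<in> carrier_vec q" for u
    using D assms(2) that by (subst assoc_mult_mat_vec[of _ N N _ q]) auto
  have inv1: "minv D *\<^sub>v (D *\<^sub>v v) = v" "D *\<^sub>v (minv D *\<^sub>v v) = v" if "v \<in> carrier_vec N" for v
    using D that assoc_mult_mat_vec[of "minv D" N N D N v] assoc_mult_mat_vec[of D N N "minv D" N v]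
    by auto
  have "range_mat (D * U) = (\<lambda>v. D *\<^sub>v v) ` range_mat U"
    using assms(2) DU by (auto simp: range_mat_def image_image intro!: image_cong)
  also have "\<dots> = (\<lambda>v. D *\<^sub>v v) ` mat_kernel T" by (simp add: ex)
  also have "\<dots> = mat_kernel (T * minv D)"
  proof (intro equalityI subsetI)
    fix w assume "w \<in> (\<lambda>v. D *\<^sub>v v) ` mat_kernel T"
    then obtain v where v: "v \<in> carrier_vec N" "T *\<^sub>v v = 0\<^sub>v m" "w = D *\<^sub>v v"
      using mat_kernelD[OF assms(3)] by blast
    show "w \<in> mat_kernel (T * minv D)"
      by (rule mat_kernelI[of _ m N]) (use v D assms(3) act inv1 in auto)
  next
    fix w assume "w \<in> mat_kernel (T * minv D)"
    then have w: "w \<in> carrier_vec N" "T * minv D *\<^sub>v w = 0\<^sub>v m"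
      using mat_kernelD[of "T * minv D" m N w] D assms(3) by auto
    have "minv D *\<^sub>v w \<in> mat_kernel T"
      by (rule mat_kernelI[OF assms(3)]) (use w D act in auto)
    then show "w \<in> (\<lambda>v. D *\<^sub>v v) ` mat_kernel T"
      using inv1(2)[OF w(1)] by (metis imageI)
  qed
  finally show ?thesis
    using inj_mat_mult[OF D(1) assms(2) inj_mat_SL[OF assms(1)] ex(1)]
      surj_mat_mult_SL[OF assms(1,3) ex(3)]
    by (simp add: short_exact_def)
qed

text \<open>For \<open>q \<noteq> N\<close> both sides are \<open>0\<close>, the default value of the determinant of a matrix that is not
  square.\<close>
lemma det_mult_SL:
  assumes "D \<in> SL N" "A \<in> carrier_mat N q"
  shows "det (D * A) = det A"
proof (cases "q = N")
  case True
  then show ?thesis using assms det_mult[of D N A] by (auto simp: SL_def)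
next
  case False
  then show ?thesis using assms by (auto simp: SL_def det_def)
qed

text \<open>If \<open>Ls\<close> represents a lift of the volume element along \<open>T D\<inverse>\<close>, then \<open>D\<inverse> Ls\<close> represents one
  along \<open>T\<close>; and \<open>(D U | L) = D (U | D\<inverse> L)\<close> has the same determinant as \<open>(U | D\<inverse> L)\<close>.\<close>
lemma has_torsion_mult_SL:
  assumes "D \<in> SL N" "U \<in> carrier_mat N q" "T \<in> carrier_mat m N" "has_torsion U T \<tau>"
  shows "has_torsion (D * U) (T * minv D) \<tau>"
  unfolding has_torsion_def
proof (intro allI impI)
  note D = SL_minv[OF assms(1)]
  fix Ls assume Ls: "vol_lift (T * minv D) Ls"
  have c: "L \<in> carrier_mat N m" if "L \<in> set Ls" for L
    using Ls that assms(3) D by (auto simp: vol_lift_def)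
  have "vol_lift T (map (\<lambda>L. minv D * L) Ls)"
  proof -
    have "T * (minv D * L) = T * minv D * L" if "L \<in> set Ls" for L
      using c[OF that] D assms(3) by simp
    then have "(\<Sum>L\<leftarrow>Ls. det (T * (minv D * L))) = (\<Sum>L\<leftarrow>Ls. det (T * minv D * L))"
      by (intro arg_cong[of _ _ sum_list] map_cong) auto
    then show ?thesis
      using Ls c D assms(3) by (auto simp: vol_lift_def o_def)
  qed
  then have "(\<Sum>L\<leftarrow>Ls. det (U @\<^sub>h (minv D * L))) = \<tau>"
    using assms(4) by (auto simp: has_torsion_def o_def)
  moreover have "det (D * U @\<^sub>h L) = det (U @\<^sub>h (minv D * L))" if "L \<in> set Ls" for L
  proof -
    have mL: "minv D * L \<in> carrier_mat N m" using c[OF that] D by auto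
    have "D * U @\<^sub>h L = D * (U @\<^sub>h (minv D * L))"
      using mult_append_cols[OF D(1) assms(2) mL] SL_cancel_left(2)[OF assms(1) c[OF that]] by simp
    then show ?thesis
      using det_mult_SL[OF assms(1) carrier_append_cols[OF assms(2) mL]] by simp
  qed
  ultimately show "(\<Sum>L\<leftarrow>Ls. det (D * U @\<^sub>h L)) = \<tau>"
    by (metis (mono_tags, lifting) map_cong)
qed

section \<open>Symmetries of the level set of the moment map\<close>

lemma cotangentD:
  assumes "B \<in> cotangent s" "a < length s"
  shows "\<alpha> B a \<in> carrier_mat (dm s (a + 1)) (dm s a)"
    "\<beta> B a \<in> carrier_mat (dm s a) (dm s (a + 1))"
  using assms by (auto simp: cotangent_def PiE_iff mem_Times_iff)

lemma X_cotangent: "B \<in> X s \<Longrightarrow> B \<in> cotangent s"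
  by (simp add: X_def)

lemma X_D:
  assumes "B \<in> X s" "1 \<le> a" "a < length s"
  shows "inj_mat (\<alpha> B a)" "\<exists>l. moment_eq s B a l"
  using assms by (simp_all add: X_def)

lemma dm_length: "dm s (length s) = sum_list s"
  by (simp add: dm_def)

lemma gauge_groupD:
  assumes "h \<in> gauge_group s"
  shows "a \<le> length s \<Longrightarrow> h a \<in> SL (dm s a)" "h (length s) = 1\<^sub>m (dm s (length s))"
  using assms by (auto simp: gauge_group_def PiE_iff)

lemma gauge_act_cotangent:
  assumes "h \<in> gauge_group s" "B \<in> cotangent s"
  shows "gauge_act s h B \<in> cotangent s"
proof -
  have "h (a + 1) * \<alpha> B a * minv (h a) \<in> carrier_mat (dm s (a + 1)) (dm s a)"
    "h a * \<beta> B a * minv (h (a + 1)) \<in> carrier_mat (dm s a) (dm s (a + 1))" if "a < length s" for a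
    using SL_minv[OF gauge_groupD(1)[OF assms(1), of a]]
      SL_minv[OF gauge_groupD(1)[OF assms(1), of "a + 1"]] cotangentD[OF assms(2) that] that
    by auto
  then show ?thesis by (auto simp: cotangent_def gauge_act_def)
qed

text \<open>Both \<open>\<alpha>\<^sub>a\<^sub>-\<^sub>1 \<beta>\<^sub>a\<^sub>-\<^sub>1\<close> and \<open>\<beta>\<^sub>a \<alpha>\<^sub>a\<close> are endomorphisms at vertex \<open>a\<close>, so the gauge group conjugates them by
  \<open>h\<^sub>a\<close> while the factors at the neighbouring vertices cancel; a scalar matrix is fixed by
  conjugation.\<close>
lemma moment_eq_gauge_act:
  assumes "h \<in> gauge_group s" "B \<in> cotangent s" "1 \<le> a" "a < length s" "moment_eq s B a l"
  shows "moment_eq s (gauge_act s h B) a l"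
proof -
  let ?p = "dm s (a - 1)" and ?q = "dm s a" and ?r = "dm s (a + 1)"
  have a1: "a - 1 + 1 = a" using assms(3) by simp
  have h: "h (a - 1) \<in> SL ?p" "h a \<in> SL ?q" "h (a + 1) \<in> SL ?r"
    using assms by (auto intro!: gauge_groupD(1))
  have c: "\<alpha> B (a - 1) \<in> carrier_mat ?q ?p" "\<beta> B (a - 1) \<in> carrier_mat ?p ?q"
    "\<alpha> B a \<in> carrier_mat ?r ?q" "\<beta> B a \<in> carrier_mat ?q ?r"
    using cotangentD[OF assms(2), of "a - 1", unfolded a1] cotangentD[OF assms(2), of a] assms(3,4)
    by auto
  note m = SL_minv[OF h(1)] SL_minv[OF h(2)] SL_minv[OF h(3)]
  have conj: "(h a * A * minv k) * (k * C * minv (h a)) = h a * (A * C) * minv (h a)"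
    if "k \<in> SL x" "A \<in> carrier_mat ?q x" "C \<in> carrier_mat x ?q" for k x A C
  proof -
    note k = SL_minv[OF that(1)]
    have "(h a * A * minv k) * (k * C * minv (h a)) = (h a * A * minv k) * (k * (C * minv (h a)))"
      using k m that by (subst assoc_mult_mat[of k x x C ?q]) auto
    also have "\<dots> = (h a * A) * (C * minv (h a))"
      by (rule SL_cancel_middle[OF that(1), of _ ?q _ ?q]) (use m that in auto)
    also have "\<dots> = h a * A * C * minv (h a)"
      using m that by (subst assoc_mult_mat[of "h a * A" ?q x C ?q]) auto
    also have "h a * A * C = h a * (A * C)"
      using m that by (subst assoc_mult_mat[of "h a" ?q ?q A x]) auto
    finally show ?thesis .
  qed
  have "\<alpha> (gauge_act s h B) (a - 1) * \<beta> (gauge_act s h B) (a - 1)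
      - \<beta> (gauge_act s h B) a * \<alpha> (gauge_act s h B) a
    = h a * (\<alpha> B (a - 1) * \<beta> B (a - 1)) * minv (h a) - h a * (\<beta> B a * \<alpha> B a) * minv (h a)"
  proof -
    have "gauge_act s h B (a - 1) =
        (h a * \<alpha> B (a - 1) * minv (h (a - 1)), h (a - 1) * \<beta> B (a - 1) * minv (h a))"
      using assms(4) by (simp only: gauge_act_def restrict_apply a1 lessThan_iff less_imp_diff_less if_True)
    moreover have "gauge_act s h B a =
        (h (a + 1) * \<alpha> B a * minv (h a), h a * \<beta> B a * minv (h (a + 1)))"
      using assms(4) by (simp only: gauge_act_def restrict_apply lessThan_iff if_True)
    ultimately show ?thesis
      by (simp only: fst_conv snd_conv conj[OF h(1) c(1,2)] conj[OF h(3) c(4,3)])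
  qed
  also have "\<dots> = h a * (\<alpha> B (a - 1) * \<beta> B (a - 1) - \<beta> B a * \<alpha> B a) * minv (h a)"
  proof -
    let ?E = "\<alpha> B (a - 1) * \<beta> B (a - 1)" and ?F = "\<beta> B a * \<alpha> B a"
    have E: "?E \<in> carrier_mat ?q ?q" "?F \<in> carrier_mat ?q ?q" using c by auto
    have "h a * (?E - ?F) * minv (h a) = (h a * ?E - h a * ?F) * minv (h a)"
      by (subst mult_minus_distrib_mat[OF m(6) E]) (rule refl)
    also have "\<dots> = h a * ?E * minv (h a) - h a * ?F * minv (h a)"
      by (rule minus_mult_distrib_mat[of _ ?q ?q]) (use E m in auto)
    finally show ?thesis ..
  qed
  also have "\<dots> = h a * (l \<cdot>\<^sub>m 1\<^sub>m ?q) * minv (h a)"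
    using assms(5) by (simp add: moment_eq_def)
  also have "\<dots> = l \<cdot>\<^sub>m (h a * 1\<^sub>m ?q * minv (h a))"
    using m(6,7)
    by (simp only: mult_smult_distrib[of _ ?q ?q _ ?q] mult_smult_assoc_mat[of _ ?q ?q _ ?q]
        one_carrier_mat mult_carrier_mat)
  also have "\<dots> = l \<cdot>\<^sub>m 1\<^sub>m ?q"
    using m(6,8) by (simp only: right_mult_one_mat)
  finally show ?thesis by (simp add: moment_eq_def)
qed

lemma gauge_act_X:
  assumes "h \<in> gauge_group s" "B \<in> X s"
  shows "gauge_act s h B \<in> X s"
proof -
  have B: "B \<in> cotangent s" using assms(2) by (rule X_cotangent)
  have "inj_mat (\<alpha> (gauge_act s h B) a)" if a: "1 \<le> a" "a < length s" for a
  proof -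
    have h: "h a \<in> SL (dm s a)" "h (a + 1) \<in> SL (dm s (a + 1))"
      using a by (auto intro!: gauge_groupD(1)[OF assms(1)])
    note m = SL_minv[OF h(1)] SL_minv[OF h(2)]
    have "inj_mat (\<alpha> B a)" using X_D(1)[OF assms(2) a] .
    then have "inj_mat (h (a + 1) * \<alpha> B a * minv (h a))"
      using m cotangentD(1)[OF B a(2)] inj_mat_SL[OF h(2)] inj_mat_SL[OF m(5)]
      by (intro inj_mat_mult[of _ "dm s (a + 1)" "dm s a"] inj_mat_mult[of _ "dm s (a + 1)" "dm s (a + 1)"])
        auto
    then show ?thesis using a by (simp add: gauge_act_def)
  qed
  moreover have "\<exists>l. moment_eq s (gauge_act s h B) a l" if "1 \<le> a" "a < length s" for a
    using X_D(2)[OF assms(2) that] moment_eq_gauge_act[OF assms(1) B that] by blast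
  ultimately show ?thesis using gauge_act_cotangent[OF assms(1) B] by (auto simp: X_def)
qed

lemma sl_act_rep_apply:
  "\<alpha> (sl_act_rep s g B) a = (if a = length s - 1 then g * \<alpha> B a else \<alpha> B a)"
  "\<beta> (sl_act_rep s g B) a = (if a = length s - 1 then \<beta> B a * minv g else \<beta> B a)"
  by (simp_all add: sl_act_rep_def)

lemma cotangent_last:
  assumes "B \<in> cotangent s" "s \<noteq> []"
  shows "\<alpha> B (length s - 1) \<in> carrier_mat (sum_list s) (dm s (length s - 1))"
    "\<beta> B (length s - 1) \<in> carrier_mat (dm s (length s - 1)) (sum_list s)"
  using cotangentD[OF assms(1), of "length s - 1"] assms(2) dm_length[of s] by auto

lemma sl_act_rep_cotangent:
  assumes "g \<in> SL (sum_list s)" "B \<in> cotangent s" "s \<noteq> []"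
  shows "sl_act_rep s g B \<in> cotangent s"
proof -
  have "length s - 1 + 1 = length s" using assms(3) by (cases s) auto
  then have "g * \<alpha> B (length s - 1)
      \<in> carrier_mat (dm s (length s - 1 + 1)) (dm s (length s - 1))"
    "\<beta> B (length s - 1) * minv g
      \<in> carrier_mat (dm s (length s - 1)) (dm s (length s - 1 + 1))"
    using cotangent_last[OF assms(2,3)] SL_minv[OF assms(1)] by (auto simp: dm_length)
  moreover have "length s - 1 < length s" using assms(3) by simp
  ultimately show ?thesis
    using assms(2) unfolding cotangent_def sl_act_rep_def
    by (auto simp: PiE_iff extensional_def)
qed

text \<open>Only \<open>\<beta>\<^sub>k\<^sub>-\<^sub>1 \<alpha>\<^sub>k\<^sub>-\<^sub>1\<close> involves the pair moved by \<open>g\<close>, and there \<open>g\<inverse>\<close> and \<open>g\<close> cancel.\<close>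
lemma moment_eq_sl_act_rep:
  assumes "g \<in> SL (sum_list s)" "B \<in> cotangent s" "1 \<le> a" "a < length s"
  shows "moment_eq s (sl_act_rep s g B) a l = moment_eq s B a l"
proof (cases "a = length s - 1")
  case True
  have "s \<noteq> []" using assms(4) by auto
  note c = cotangent_last[OF assms(2) this]
  have "(\<beta> B a * minv g) * (g * \<alpha> B a) = \<beta> B a * \<alpha> B a"
    using c True by (intro SL_cancel_middle[OF assms(1)]) auto
  moreover have "a - 1 \<noteq> length s - 1" using assms(3) True by simp
  ultimately show ?thesis
    using True by (simp add: moment_eq_def sl_act_rep_apply)
next
  case False
  moreover have "a - 1 \<noteq> length s - 1" using assms(3,4) by simp
  ultimately show ?thesis by (simp add: moment_eq_def sl_act_rep_apply)
qed

lemma moment_scalar_sl_act_rep: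
  assumes "g \<in> SL (sum_list s)" "B \<in> cotangent s" "1 \<le> a" "a < length s"
  shows "moment_scalar s (sl_act_rep s g B) a = moment_scalar s B a"
  by (simp add: moment_scalar_def moment_eq_sl_act_rep[OF assms])

lemma sl_act_rep_X:
  assumes "g \<in> SL (sum_list s)" "B \<in> X s" "s \<noteq> []"
  shows "sl_act_rep s g B \<in> X s"
proof -
  have B: "B \<in> cotangent s" using assms(2) by (rule X_cotangent)
  have "inj_mat (\<alpha> (sl_act_rep s g B) a)" if a: "1 \<le> a" "a < length s" for a
  proof -
    have "inj_mat (\<alpha> B a)" using X_D(1)[OF assms(2) a] .
    then show ?thesis
      using inj_mat_mult[OF SL_minv(1)[OF assms(1)] cotangent_last(1)[OF B assms(3)]
          inj_mat_SL[OF assms(1)]]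
      by (auto simp: sl_act_rep_apply)
  qed
  moreover have "\<exists>l. moment_eq s (sl_act_rep s g B) a l" if "1 \<le> a" "a < length s" for a
    using X_D(2)[OF assms(2) that] by (simp add: moment_eq_sl_act_rep[OF assms(1) B that])
  ultimately show ?thesis
    using sl_act_rep_cotangent[OF assms(1) B assms(3)] by (auto simp: X_def)
qed

lemma sl_act_rep_minv:
  assumes "g \<in> SL (sum_list s)" "B \<in> cotangent s" "s \<noteq> []"
  shows "sl_act_rep s (minv g) (sl_act_rep s g B) = B"
  using SL_cancel_left(1)[OF assms(1) cotangent_last(1)[OF assms(2,3)]]
    SL_cancel_right(1)[OF assms(1) cotangent_last(2)[OF assms(2,3)]]
  by (simp add: sl_act_rep_def minv_minv[OF assms(1)])

text \<open>The gauge group acts at vertices \<open>1, \<dots>, k - 1\<close> and \<open>g\<close> at vertex \<open>k\<close>. On the last pair they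
  multiply from opposite sides, since the gauge component at \<open>k\<close> is the identity.\<close>
lemma gauge_act_sl_act_rep:
  assumes "g \<in> SL (sum_list s)" "h \<in> gauge_group s" "B \<in> cotangent s" "s \<noteq> []"
  shows "gauge_act s h (sl_act_rep s g B) = sl_act_rep s g (gauge_act s h B)"
proof (rule ext)
  fix a
  let ?k = "length s - 1"
  have k: "Suc ?k = length s" "?k < length s" using assms(4) by auto
  note c = cotangent_last[OF assms(3,4)]
  note m = SL_minv[OF assms(1)]
  note n = SL_minv[OF gauge_groupD(1)[OF assms(2), of ?k]]
  have one: "h (length s) = 1\<^sub>m (sum_list s)"
    using gauge_groupD(2)[OF assms(2)] by (simp add: dm_length)
  show "gauge_act s h (sl_act_rep s g B) a = sl_act_rep s g (gauge_act s h B) a"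
  proof (cases "a = ?k")
    case True
    have "g * \<alpha> B ?k * minv (h ?k) = g * (\<alpha> B ?k * minv (h ?k))"
      "h ?k * (\<beta> B ?k * minv g) = h ?k * \<beta> B ?k * minv g"
      using c m n by (auto simp: assoc_mult_mat[of _ "sum_list s" "sum_list s"]
          assoc_mult_mat[of _ "dm s ?k" "dm s ?k"])
    then show ?thesis
      using True k c m n one
      by (simp add: gauge_act_def sl_act_rep_def minv_one del: assoc_mult_mat)
  next
    case False
    then show ?thesis by (simp add: gauge_act_def sl_act_rep_def restrict_def)
  qed
qed

section \<open>The ring of invariant functions\<close>

lemma regular_fun_at:
  assumes "regular_fun s f" "B \<in> X s"
  obtains p q where "p \<in> poly_fun s" "q \<in> poly_fun s" "q B \<noteq> 0"
    "\<forall>C\<in>X s. q C \<noteq> 0 \<longrightarrow> f C = p C / q C"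
  using assms unfolding regular_fun_def by blast

lemma regular_fun_const: "regular_fun s (const_fun s c)"
  unfolding regular_fun_def
  by (intro ballI bexI[of _ "\<lambda>B. c"] bexI[of _ "\<lambda>B. 1"]) (auto simp: const_fun_def intro: poly_fun.const)

lemma regular_fun_add:
  assumes "regular_fun s f" "regular_fun s h"
  shows "regular_fun s (\<lambda>B\<in>X s. f B + h B)"
  unfolding regular_fun_def
proof
  fix B assume B: "B \<in> X s"
  obtain p q where P: "p \<in> poly_fun s" "q \<in> poly_fun s" "q B \<noteq> 0"
      "\<forall>C\<in>X s. q C \<noteq> 0 \<longrightarrow> f C = p C / q C"
    by (rule regular_fun_at[OF assms(1) B])
  obtain p' q' where P': "p' \<in> poly_fun s" "q' \<in> poly_fun s" "q' B \<noteq> 0"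
      "\<forall>C\<in>X s. q' C \<noteq> 0 \<longrightarrow> h C = p' C / q' C"
    by (rule regular_fun_at[OF assms(2) B])
  show "\<exists>p\<in>poly_fun s. \<exists>q\<in>poly_fun s. q B \<noteq> 0 \<and>
      (\<forall>C\<in>X s. q C \<noteq> 0 \<longrightarrow> (\<lambda>B\<in>X s. f B + h B) C = p C / q C)"
  proof (intro bexI conjI ballI impI)
    fix C assume "C \<in> X s" "q C * q' C \<noteq> 0"
    then have "f C = p C / q C" "h C = p' C / q' C" "q C \<noteq> 0" "q' C \<noteq> 0"
      using P(4) P'(4) by simp_all
    then show "(\<lambda>B\<in>X s. f B + h B) C = (p C * q' C + p' C * q C) / (q C * q' C)"
      using \<open>C \<in> X s\<close> by (simp add: add_frac_eq)
  next
    show "q B * q' B \<noteq> 0" using P(3) P'(3) by simp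
  qed (intro poly_fun.add poly_fun.mult P P')+
qed

lemma regular_fun_mult:
  assumes "regular_fun s f" "regular_fun s h"
  shows "regular_fun s (\<lambda>B\<in>X s. f B * h B)"
  unfolding regular_fun_def
proof
  fix B assume B: "B \<in> X s"
  obtain p q where P: "p \<in> poly_fun s" "q \<in> poly_fun s" "q B \<noteq> 0"
      "\<forall>C\<in>X s. q C \<noteq> 0 \<longrightarrow> f C = p C / q C"
    by (rule regular_fun_at[OF assms(1) B])
  obtain p' q' where P': "p' \<in> poly_fun s" "q' \<in> poly_fun s" "q' B \<noteq> 0"
      "\<forall>C\<in>X s. q' C \<noteq> 0 \<longrightarrow> h C = p' C / q' C"
    by (rule regular_fun_at[OF assms(2) B])
  show "\<exists>p\<in>poly_fun s. \<exists>q\<in>poly_fun s. q B \<noteq> 0 \<and>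
      (\<forall>C\<in>X s. q C \<noteq> 0 \<longrightarrow> (\<lambda>B\<in>X s. f B * h B) C = p C / q C)"
  proof (intro bexI conjI ballI impI)
    fix C assume "C \<in> X s" "q C * q' C \<noteq> 0"
    then have "f C = p C / q C" "h C = p' C / q' C" "q C \<noteq> 0" "q' C \<noteq> 0"
      using P(4) P'(4) by simp_all
    then show "(\<lambda>B\<in>X s. f B * h B) C = (p C * p' C) / (q C * q' C)"
      using \<open>C \<in> X s\<close> by (simp add: times_divide_times_eq)
  next
    show "q B * q' B \<noteq> 0" using P(3) P'(3) by simp
  qed (intro poly_fun.add poly_fun.mult P P')+
qed

lemma carrier_inv_ring:
  "f \<in> carrier (inv_ring s) \<longleftrightarrow> f \<in> extensional (X s) \<and> regular_fun s f \<and>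
     (\<forall>g\<in>gauge_group s. \<forall>B\<in>X s. f (gauge_act s g B) = f B)"
  by (simp add: inv_ring_def)

lemma inv_ring_ops:
  "f \<otimes>\<^bsub>inv_ring s\<^esub> h = (\<lambda>B\<in>X s. f B * h B)"
  "f \<oplus>\<^bsub>inv_ring s\<^esub> h = (\<lambda>B\<in>X s. f B + h B)"
  "\<one>\<^bsub>inv_ring s\<^esub> = const_fun s 1" "\<zero>\<^bsub>inv_ring s\<^esub> = const_fun s 0"
  by (simp_all add: inv_ring_def)

lemma const_fun_carrier: "const_fun s c \<in> carrier (inv_ring s)"
  by (simp add: carrier_inv_ring regular_fun_const) (simp add: const_fun_def gauge_act_X)

text \<open>Off \<open>X s\<close> all members take a default value, so invariance of a pointwise sum or product also uses that
  the gauge group preserves \<open>X s\<close>.\<close>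
lemma inv_ring_closed:
  assumes "f \<in> carrier (inv_ring s)" "h \<in> carrier (inv_ring s)"
  shows "(\<lambda>B\<in>X s. f B + h B) \<in> carrier (inv_ring s)" "(\<lambda>B\<in>X s. f B * h B) \<in> carrier (inv_ring s)"
  using assms by (simp_all add: carrier_inv_ring regular_fun_add regular_fun_mult gauge_act_X)

lemma inv_ring_ext:
  assumes "f \<in> carrier (inv_ring s)" "h \<in> carrier (inv_ring s)" "\<And>B. B \<in> X s \<Longrightarrow> f B = h B"
  shows "f = h"
  using assms by (intro extensionalityI[of f "X s" h]) (auto simp: carrier_inv_ring)

lemma inv_ring_cring: "cring (inv_ring s)"
proof (rule cringI)
  show "abelian_group (inv_ring s)"
  proof (rule abelian_groupI)
    fix f assume f: "f \<in> carrier (inv_ring s)"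
    show "\<zero>\<^bsub>inv_ring s\<^esub> \<oplus>\<^bsub>inv_ring s\<^esub> f = f"
      by (rule inv_ring_ext[OF _ f])
        (simp_all add: inv_ring_ops inv_ring_closed const_fun_carrier f, simp add: const_fun_def)
    let ?m = "\<lambda>B\<in>X s. const_fun s (-1) B * f B"
    have "?m \<in> carrier (inv_ring s)" by (rule inv_ring_closed(2)[OF const_fun_carrier f])
    moreover have "?m \<oplus>\<^bsub>inv_ring s\<^esub> f = \<zero>\<^bsub>inv_ring s\<^esub>"
      by (simp add: inv_ring_ops const_fun_def cong: restrict_cong)
    ultimately show "\<exists>y\<in>carrier (inv_ring s). y \<oplus>\<^bsub>inv_ring s\<^esub> f = \<zero>\<^bsub>inv_ring s\<^esub>" by blast
  qed (simp_all add: inv_ring_ops inv_ring_closed const_fun_carrier add_ac cong: restrict_cong)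
  show "comm_monoid (inv_ring s)"
  proof (rule comm_monoidI)
    fix f assume f: "f \<in> carrier (inv_ring s)"
    show "\<one>\<^bsub>inv_ring s\<^esub> \<otimes>\<^bsub>inv_ring s\<^esub> f = f"
      by (rule inv_ring_ext[OF _ f])
        (simp_all add: inv_ring_ops inv_ring_closed const_fun_carrier f, simp add: const_fun_def)
  qed (simp_all add: inv_ring_ops inv_ring_closed const_fun_carrier mult_ac cong: restrict_cong)
qed (simp add: inv_ring_ops distrib_right cong: restrict_cong)

section \<open>Algebra isomorphisms and spectra\<close>

lemma Spec_map_ring_iso:
  assumes "cring R" "cring S" "h \<in> ring_iso R S" "p \<in> Spec S"
  shows "Spec_map R h p \<in> Spec R"
proof -
  have "ring_hom_ring R S h"
    using assms(1-3) by (intro ring_hom_ringI2) (auto simp: ring_iso_def cring_def)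
  then show ?thesis
    using ring_hom_ring.primeideal_vimage[OF _ assms(1), of S h p] assms(4)
    by (simp add: Spec_def Spec_map_def)
qed

lemma Spec_subset_carrier: "p \<in> Spec R \<Longrightarrow> p \<subseteq> carrier R"
  by (auto simp: Spec_def dest: primeideal.axioms(1) ideal.axioms(1) additive_subgroup.a_Hcarr)

lemma Spec_map_inverse:
  assumes "\<And>r. r \<in> carrier R \<Longrightarrow> h r \<in> carrier S \<and> k (h r) = r" "p \<in> Spec R"
  shows "Spec_map R h (Spec_map S k p) = p"
  using assms(1) Spec_subset_carrier[OF assms(2)] by (auto simp: Spec_map_def)

lemma Spec_map_bij:
  assumes "cring R" "cring S" "h \<in> ring_iso R S"
  shows "bij_betw (Spec_map R h) (Spec S) (Spec R)"
proof -
  let ?k = "inv_into (carrier R) h"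
  have k: "?k \<in> ring_iso S R"
    using assms by (intro ring_iso_set_sym) (auto simp: cring_def)
  have bij: "bij_betw h (carrier R) (carrier S)" using assms(3) by (simp add: ring_iso_def)
  have "h r \<in> carrier S \<and> ?k (h r) = r" if "r \<in> carrier R" for r
    using bij that by (auto simp: bij_betw_def)
  moreover have "?k r \<in> carrier R \<and> h (?k r) = r" if "r \<in> carrier S" for r
    using bij that by (auto simp: bij_betw_def inv_into_into f_inv_into_f)
  ultimately show ?thesis
    using Spec_map_ring_iso[OF assms] Spec_map_ring_iso[OF assms(2,1) k]
    by (intro bij_betw_byWitness[of _ "Spec_map S ?k"]) (auto simp: Spec_map_inverse)
qed

lemma scheme_iso_bij:
  assumes "scheme_iso s s' \<Phi>"
  shows "bij_betw \<Phi> (M s) (M s')"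
proof -
  obtain h where h: "h \<in> ring_iso (inv_ring s') (inv_ring s)"
    "\<Phi> = restrict (Spec_map (inv_ring s') h) (M s)"
    using assms by (auto simp: scheme_iso_def)
  have "bij_betw (Spec_map (inv_ring s') h) (M s) (M s')"
    unfolding M_def by (rule Spec_map_bij[OF inv_ring_cring inv_ring_cring h(1)])
  then show ?thesis by (subst bij_betw_cong[of _ _ "Spec_map (inv_ring s') h"]) (simp_all add: h(2))
qed

text \<open>The points of \<open>X s\<close> give points of the spectrum because evaluation is a homomorphism to a
  field: its kernel is prime.\<close>
lemma pt_in_M:
  assumes "B \<in> X s"
  shows "pt s B \<in> M s"
proof -
  interpret R: cring "inv_ring s" by (rule inv_ring_cring)
  have "additive_subgroup (pt s B) (inv_ring s)"
  proof (rule additive_subgroupI, rule R.a_group[THEN group.subgroupI], goal_cases)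
    case 1
    then show ?case by (auto simp: pt_def)
  next
    case 2
    have "const_fun s 0 \<in> pt s B"
      using assms by (simp add: pt_def const_fun_carrier) (simp add: const_fun_def)
    then show ?case by blast
  next
    case (3 f)
    then have f: "f \<in> carrier (inv_ring s)" "f B = 0" by (auto simp: pt_def)
    have "(f \<oplus>\<^bsub>inv_ring s\<^esub> \<ominus>\<^bsub>inv_ring s\<^esub> f) B = \<zero>\<^bsub>inv_ring s\<^esub> B"
      using R.r_neg[OF f(1)] by simp
    then have "(\<ominus>\<^bsub>inv_ring s\<^esub> f) B = 0"
      using assms f(2) by (simp add: inv_ring_ops const_fun_def)
    then have "\<ominus>\<^bsub>inv_ring s\<^esub> f \<in> pt s B" using f(1) by (simp add: pt_def)
    then show ?case by (simp only: a_inv_def)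
  next
    case (4 f h)
    then show ?case
      using assms by (auto simp: pt_def) (auto simp: inv_ring_ops inv_ring_closed)
  qed
  then have "primeideal (pt s B) (inv_ring s)"
  proof (rule primeidealI2[OF _ inv_ring_cring])
    show "carrier (inv_ring s) \<noteq> pt s B"
    proof
      assume "carrier (inv_ring s) = pt s B"
      then have "const_fun s 1 \<in> pt s B" using const_fun_carrier by blast
      then show False using assms by (simp add: pt_def const_fun_def)
    qed
  qed (use assms in \<open>auto simp: pt_def inv_ring_ops inv_ring_closed\<close>)
  then show ?thesis by (simp add: M_def Spec_def)
qed

section \<open>The action on invariant functions\<close>

text \<open>The comorphism of the automorphism of \<open>M s\<close> given by \<open>g\<close>.\<close>
definition sl_pull :: "nat list \<Rightarrow> complex mat \<Rightarrow> (rep \<Rightarrow> complex) \<Rightarrow> rep \<Rightarrow> complex" where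
  "sl_pull s g f = (\<lambda>B\<in>X s. f (sl_act_rep s g B))"

lemma sl_act_eq: "sl_act s g = Spec_map (inv_ring s) (sl_pull s g)"
  by (simp only: sl_act_def sl_pull_def[abs_def])

lemma poly_fun_sum:
  assumes "finite I" "\<And>j. j \<in> I \<Longrightarrow> f j \<in> poly_fun s"
  shows "(\<lambda>B. \<Sum>j\<in>I. f j B) \<in> poly_fun s"
  using assms by (induction I rule: finite_induct) (auto intro: poly_fun.const poly_fun.add)

text \<open>The entries of \<open>g \<alpha>\<close> and \<open>\<beta> g\<inverse>\<close> are linear in those of \<open>\<alpha>\<close> and \<open>\<beta>\<close>. The agreement is claimed on
  \<open>cotangent s\<close> only: elsewhere the matrices may have the wrong size, and a matrix product is then not
  given by the polynomial formula.\<close>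
lemma poly_fun_sl_act_rep:
  assumes "g \<in> SL (sum_list s)" "s \<noteq> []" "p \<in> poly_fun s"
  shows "\<exists>q\<in>poly_fun s. \<forall>B\<in>cotangent s. q B = p (sl_act_rep s g B)"
  using assms(3)
proof (induction rule: poly_fun.induct)
  case (const c)
  show ?case by (rule bexI[of _ "\<lambda>B. c"]) (auto intro: poly_fun.const)
next
  case (alpha a r c)
  show ?case
  proof (cases "a = length s - 1")
    case True
    let ?n = "sum_list s"
    have dims: "dm s (a + 1) = ?n" using True assms(2) dm_length[of s] by (cases s) auto
    have "(g * \<alpha> B a) $$ (r, c) = (\<Sum>j<?n. g $$ (r, j) * \<alpha> B a $$ (j, c))"
      if "B \<in> cotangent s" for B
      using cotangent_last(1)[OF that assms(2)] SL_minv(1)[OF assms(1)] alpha dims True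
      by (auto simp: scalar_prod_def atLeast0LessThan intro!: sum.cong)
    moreover have "(\<lambda>B. \<Sum>j<?n. g $$ (r, j) * \<alpha> B a $$ (j, c)) \<in> poly_fun s"
      using alpha dims
      by (intro poly_fun_sum poly_fun.mult poly_fun.const poly_fun.alpha) auto
    ultimately show ?thesis
      using True by (intro bexI) (auto simp: sl_act_rep_apply)
  next
    case False
    then show ?thesis
      using alpha by (intro bexI[of _ "\<lambda>B. \<alpha> B a $$ (r, c)"])
        (auto simp: sl_act_rep_apply intro: poly_fun.alpha)
  qed
next
  case (beta a r c)
  show ?case
  proof (cases "a = length s - 1")
    case True
    let ?n = "sum_list s"
    have dims: "dm s (a + 1) = ?n" using True assms(2) dm_length[of s] by (cases s) auto
    have "(\<beta> B a * minv g) $$ (r, c) = (\<Sum>j<?n. \<beta> B a $$ (r, j) * minv g $$ (j, c))"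
      if "B \<in> cotangent s" for B
      using cotangent_last(2)[OF that assms(2)] SL_minv(2)[OF assms(1)] beta dims True
      by (auto simp: scalar_prod_def atLeast0LessThan intro!: sum.cong)
    moreover have "(\<lambda>B. \<Sum>j<?n. \<beta> B a $$ (r, j) * minv g $$ (j, c)) \<in> poly_fun s"
      using beta dims
      by (intro poly_fun_sum poly_fun.mult poly_fun.const poly_fun.beta) auto
    ultimately show ?thesis
      using True by (intro bexI) (auto simp: sl_act_rep_apply)
  next
    case False
    then show ?thesis
      using beta by (intro bexI[of _ "\<lambda>B. \<beta> B a $$ (r, c)"])
        (auto simp: sl_act_rep_apply intro: poly_fun.beta)
  qed
next
  case (add p q)
  then obtain p' q' where "p' \<in> poly_fun s" "q' \<in> poly_fun s"
    "\<forall>B\<in>cotangent s. p' B = p (sl_act_rep s g B)" "\<forall>B\<in>cotangent s. q' B = q (sl_act_rep s g B)"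
    by blast
  then show ?case
    by (intro bexI[of _ "\<lambda>B. p' B + q' B"]) (auto intro: poly_fun.add)
next
  case (mult p q)
  then obtain p' q' where "p' \<in> poly_fun s" "q' \<in> poly_fun s"
    "\<forall>B\<in>cotangent s. p' B = p (sl_act_rep s g B)" "\<forall>B\<in>cotangent s. q' B = q (sl_act_rep s g B)"
    by blast
  then show ?case
    by (intro bexI[of _ "\<lambda>B. p' B * q' B"]) (auto intro: poly_fun.mult)
qed

lemma regular_fun_sl_pull:
  assumes "g \<in> SL (sum_list s)" "s \<noteq> []" "regular_fun s f"
  shows "regular_fun s (sl_pull s g f)"
  unfolding regular_fun_def
proof
  fix B assume B: "B \<in> X s"
  obtain p q where P: "p \<in> poly_fun s" "q \<in> poly_fun s" "q (sl_act_rep s g B) \<noteq> 0"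
      "\<forall>C\<in>X s. q C \<noteq> 0 \<longrightarrow> f C = p C / q C"
    by (rule regular_fun_at[OF assms(3) sl_act_rep_X[OF assms(1) B assms(2)]])
  obtain p' q' where Q: "p' \<in> poly_fun s" "q' \<in> poly_fun s"
    "\<And>C. C \<in> cotangent s \<Longrightarrow> p' C = p (sl_act_rep s g C)"
    "\<And>C. C \<in> cotangent s \<Longrightarrow> q' C = q (sl_act_rep s g C)"
    using poly_fun_sl_act_rep[OF assms(1,2) P(1)] poly_fun_sl_act_rep[OF assms(1,2) P(2)] by metis
  show "\<exists>p\<in>poly_fun s. \<exists>q\<in>poly_fun s. q B \<noteq> 0 \<and>
      (\<forall>C\<in>X s. q C \<noteq> 0 \<longrightarrow> sl_pull s g f C = p C / q C)"
  proof (intro bexI conjI ballI impI)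
    fix C assume C: "C \<in> X s" "q' C \<noteq> 0"
    then show "sl_pull s g f C = p' C / q' C"
      using P(4)[rule_format, OF sl_act_rep_X[OF assms(1) C(1) assms(2)]] Q(3,4) X_cotangent
      by (simp add: sl_pull_def)
  next
    show "q' B \<noteq> 0" using P(3) Q(4) X_cotangent[OF B] by simp
  qed (rule Q)+
qed

lemma sl_pull_carrier:
  assumes "g \<in> SL (sum_list s)" "s \<noteq> []" "f \<in> carrier (inv_ring s)"
  shows "sl_pull s g f \<in> carrier (inv_ring s)"
  using assms
  by (auto simp: carrier_inv_ring regular_fun_sl_pull)
    (auto simp: sl_pull_def gauge_act_X sl_act_rep_X gauge_act_sl_act_rep[symmetric] X_cotangent)

lemma sl_pull_minv:
  assumes "g \<in> SL (sum_list s)" "s \<noteq> []" "f \<in> carrier (inv_ring s)"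
  shows "sl_pull s g (sl_pull s (minv g) f) = f"
proof (rule inv_ring_ext[OF _ assms(3)])
  show "sl_pull s g (sl_pull s (minv g) f) \<in> carrier (inv_ring s)"
    by (intro sl_pull_carrier assms SL_minv(5))
  show "sl_pull s g (sl_pull s (minv g) f) B = f B" if "B \<in> X s" for B
    using sl_act_rep_X[OF assms(1) that assms(2)] sl_act_rep_minv[OF assms(1) X_cotangent[OF that] assms(2)] that
    by (simp add: sl_pull_def)
qed

lemma sl_pull_minv':
  assumes "g \<in> SL (sum_list s)" "s \<noteq> []" "f \<in> carrier (inv_ring s)"
  shows "sl_pull s (minv g) (sl_pull s g f) = f"
  using sl_pull_minv[OF SL_minv(5)[OF assms(1)] assms(2,3)] by (simp add: minv_minv[OF assms(1)])

lemma sl_pull_const: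
  assumes "g \<in> SL (sum_list s)" "s \<noteq> []"
  shows "sl_pull s g (const_fun s c) = const_fun s c"
  using sl_act_rep_X[OF assms(1) _ assms(2)]
  by (simp add: sl_pull_def const_fun_def cong: restrict_cong)

lemma sl_pull_ring_iso:
  assumes "g \<in> SL (sum_list s)" "s \<noteq> []"
  shows "sl_pull s g \<in> ring_iso (inv_ring s) (inv_ring s)"
proof (rule ring_iso_memI)
  show "bij_betw (sl_pull s g) (carrier (inv_ring s)) (carrier (inv_ring s))"
    by (rule bij_betw_byWitness[of _ "sl_pull s (minv g)"])
      (use assms sl_pull_carrier SL_minv(5) in \<open>auto simp: sl_pull_minv sl_pull_minv'\<close>)
qed (use assms sl_act_rep_X[OF assms(1) _ assms(2)] in
    \<open>simp_all add: sl_pull_carrier inv_ring_ops sl_pull_const,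
     simp_all add: sl_pull_def cong: restrict_cong\<close>)

lemma sl_act_M:
  assumes "g \<in> SL (sum_list s)" "s \<noteq> []" "x \<in> M s"
  shows "sl_act s g x \<in> M s"
  using Spec_map_ring_iso[OF inv_ring_cring inv_ring_cring sl_pull_ring_iso[OF assms(1,2)]] assms(3)
  by (simp add: sl_act_eq M_def)

lemma sl_act_minv:
  assumes "g \<in> SL (sum_list s)" "s \<noteq> []" "x \<in> M s"
  shows "sl_act s g (sl_act s (minv g) x) = x"
  unfolding sl_act_eq
  by (rule Spec_map_inverse)
    (use assms sl_pull_carrier in \<open>auto simp: sl_pull_minv' M_def\<close>)

lemma sl_act_pt:
  assumes "g \<in> SL (sum_list s)" "s \<noteq> []" "B \<in> X s"
  shows "sl_act s g (pt s B) = pt s (sl_act_rep s g B)"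
proof -
  have "sl_pull s g f B = f (sl_act_rep s g B)" for f
    using assms(3) by (simp add: sl_pull_def)
  then show ?thesis
    using sl_pull_carrier[OF assms(1,2)] unfolding sl_act_eq Spec_map_def pt_def by auto
qed

section \<open>Invariance of the zipper\<close>

lemma i_swapped_length: "i_swapped i s s' \<Longrightarrow> length s' = length s"
  by (auto simp: i_swapped_def)

lemma i_swapped_sym:
  assumes "i_swapped i s s'"
  shows "i_swapped i s' s"
proof -
  have i: "1 \<le> i" "i < length s" and s': "s' = s[i - 1 := s ! i, i := s ! (i - 1)]"
    using assms by (auto simp: i_swapped_def)
  have "s = s'[i - 1 := s' ! i, i := s' ! (i - 1)]"
  proof (rule nth_equalityI)
    fix a assume "a < length s"
    then show "s ! a = s'[i - 1 := s' ! i, i := s' ! (i - 1)] ! a"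
      using i by (cases "a = i"; cases "a = i - 1") (simp_all add: s')
  qed (simp add: s')
  then show ?thesis using i by (simp add: i_swapped_def s')
qed

text \<open>The partial sum up to \<open>i + 1\<close> contains both of the swapped sizes, the one up to \<open>i - 1\<close> neither.
  Hence \<open>B\<close> and \<open>B'\<close> have the same spaces next to vertex \<open>i\<close>.\<close>
lemma i_swapped_dm:
  assumes "i_swapped i s s'"
  shows "dm s' (i - 1) = dm s (i - 1)" "dm s' (i + 1) = dm s (i + 1)"
proof -
  have i: "1 \<le> i" "i < length s" and s': "s' = s[i - 1 := s ! i, i := s ! (i - 1)]"
    using assms by (auto simp: i_swapped_def)
  show "dm s' (i - 1) = dm s (i - 1)" using i by (simp add: dm_def s')
  let ?t = "take (i + 1) s"
  have "take (i + 1) s' = ?t[i - 1 := ?t ! i, i := ?t ! (i - 1)]"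
    using i by (simp add: s' take_update_swap)
  then have "mset (take (i + 1) s') = mset ?t"
    using i mset_swap[of i ?t "i - 1"] by simp
  then show "dm s' (i + 1) = dm s (i + 1)"
    unfolding dm_def by (metis sum_mset_sum_list)
qed

text \<open>The action of \<open>g\<close> on the sum of the two spaces next to vertex \<open>i\<close>. Since
  \<open>g\<close> acts at vertex \<open>k\<close> alone, this is the identity unless \<open>i + 1 = k\<close>.\<close>
definition neighbour_act :: "nat \<Rightarrow> nat list \<Rightarrow> complex mat \<Rightarrow> complex mat" where
  "neighbour_act i s g = (if i = length s - 1 then lower_block (dm s (i - 1)) (sum_list s) g
     else 1\<^sub>m (dm s (i - 1) + dm s (i + 1)))"

lemma neighbour_act_SL:
  assumes "g \<in> SL (sum_list s)" "s \<noteq> []"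
  shows "neighbour_act i s g \<in> SL (dm s (i - 1) + dm s (i + 1))"
  using lower_block_SL[OF assms(1)] assms(2) dm_length[of s]
  by (cases "i = length s - 1") (auto simp: neighbour_act_def one_in_SL)

lemma out_in_mat_carrier:
  assumes "B \<in> cotangent s" "1 \<le> i" "i < length s"
  shows "out_mat i B \<in> carrier_mat (dm s (i - 1) + dm s (i + 1)) (dm s i)"
    "in_mat i B \<in> carrier_mat (dm s i) (dm s (i - 1) + dm s (i + 1))"
  using cotangentD[OF assms(1), of "i - 1"] cotangentD[OF assms(1,3)] assms(2,3)
  by (auto simp: out_mat_def in_mat_def intro!: carrier_append_rows carrier_append_cols)

lemma out_in_mat_sl_act_rep:
  assumes "g \<in> SL (sum_list s)" "B \<in> cotangent s" "1 \<le> i" "i < length s"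
  shows "out_mat i (sl_act_rep s g B) = neighbour_act i s g * out_mat i B"
    "in_mat i (sl_act_rep s g B) = in_mat i B * minv (neighbour_act i s g)"
proof -
  note c = cotangentD[OF assms(2), of "i - 1"] and d = cotangentD[OF assms(2,4)]
  have prev: "i - 1 \<noteq> length s - 1" using assms(3,4) by simp
  note g = SL_minv[OF assms(1)]
  note carr = out_in_mat_carrier[OF assms(2-4)]
  have "out_mat i (sl_act_rep s g B) = neighbour_act i s g * out_mat i B \<and>
    in_mat i (sl_act_rep s g B) = in_mat i B * minv (neighbour_act i s g)"
  proof (cases "i = length s - 1")
    case True
    have n: "dm s (i + 1) = sum_list s"
      using True assms(4) by (simp add: dm_def)
    have "\<beta> B (i - 1) \<in> carrier_mat (dm s (i - 1)) (dm s i)"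
      "\<alpha> B i \<in> carrier_mat (sum_list s) (dm s i)"
      using c(2) d(1) n assms(3,4) by simp_all
    from lower_block_append_rows[OF g(1) this]
    have "out_mat i (sl_act_rep s g B) = neighbour_act i s g * out_mat i B"
      using True prev by (simp add: out_mat_def neighbour_act_def sl_act_rep_apply)
    moreover have "- \<alpha> B (i - 1) \<in> carrier_mat (dm s i) (dm s (i - 1))"
      "\<beta> B i \<in> carrier_mat (dm s i) (sum_list s)"
      using c(1) d(2) n assms(3,4) by simp_all
    from append_cols_lower_block[OF g(2) this]
    have "in_mat i (sl_act_rep s g B) = in_mat i B * minv (neighbour_act i s g)"
      using True prev
      by (simp add: in_mat_def neighbour_act_def sl_act_rep_apply lower_block_minv[OF assms(1)])
    ultimately show ?thesis ..
  next
    case False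
    then show ?thesis
      using prev carr by (simp add: neighbour_act_def minv_one) (simp add: out_mat_def in_mat_def sl_act_rep_apply)
  qed
  then show "out_mat i (sl_act_rep s g B) = neighbour_act i s g * out_mat i B"
    "in_mat i (sl_act_rep s g B) = in_mat i B * minv (neighbour_act i s g)" by blast+
qed

text \<open>Both sides of the relation between \<open>U' T'\<close> and \<open>U T\<close> are conjugated by \<open>D\<close>, which fixes the
  scalar matrix. The zipper relates the products of \<open>out\<^sub>i\<close> and \<open>in\<^sub>i\<close> for \<open>B'\<close> and \<open>B\<close> in this way.\<close>
lemma conjugate_add_scalar:
  assumes "D \<in> SL N" "U \<in> carrier_mat N q" "T \<in> carrier_mat q N"
    "U' \<in> carrier_mat N r" "T' \<in> carrier_mat r N" "U' * T' = U * T + l \<cdot>\<^sub>m 1\<^sub>m N"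
  shows "(D * U') * (T' * minv D) = (D * U) * (T * minv D) + l \<cdot>\<^sub>m 1\<^sub>m N"
proof -
  note D = SL_minv[OF assms(1)]
  have regroup: "(D * V) * (W * minv D) = D * (V * W) * minv D"
    if "V \<in> carrier_mat N x" "W \<in> carrier_mat x N" for V W x
  proof -
    have "D * V * (W * minv D) = D * V * W * minv D"
      using that D by (subst assoc_mult_mat[of "D * V" N x W N]) auto
    also have "D * V * W = D * (V * W)"
      using that D by (subst assoc_mult_mat[of D N N V x]) auto
    finally show ?thesis .
  qed
  have UT: "U * T \<in> carrier_mat N N" using assms by auto
  have I: "l \<cdot>\<^sub>m 1\<^sub>m N \<in> carrier_mat N N" by auto
  have "D * (l \<cdot>\<^sub>m 1\<^sub>m N) * minv D = (l \<cdot>\<^sub>m D) * minv D"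
    by (subst mult_smult_distrib[OF D(1) one_carrier_mat]) (simp only: right_mult_one_mat[OF D(1)])
  also have "\<dots> = l \<cdot>\<^sub>m 1\<^sub>m N"
    by (subst mult_smult_assoc_mat[OF D(1,2)]) (simp only: D(3))
  finally have scal: "D * (l \<cdot>\<^sub>m 1\<^sub>m N) * minv D = l \<cdot>\<^sub>m 1\<^sub>m N" .
  have "(D * U') * (T' * minv D) = D * (U * T + l \<cdot>\<^sub>m 1\<^sub>m N) * minv D"
    by (simp only: regroup[OF assms(4,5)] assms(6))
  also have "\<dots> = (D * (U * T) + D * (l \<cdot>\<^sub>m 1\<^sub>m N)) * minv D"
    by (simp only: mult_add_distrib_mat[OF D(1) UT I])
  also have "\<dots> = D * (U * T) * minv D + D * (l \<cdot>\<^sub>m 1\<^sub>m N) * minv D"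
    by (rule add_mult_distrib_mat[of _ N N]) (use UT I D in auto)
  finally show ?thesis by (simp only: scal regroup[OF assms(2,3)])
qed

lemma zipper_sl_act_rep:
  assumes "i_swapped i s s'" "sum_list s' = sum_list s" "g \<in> SL (sum_list s)"
    "(B, B') \<in> zipper i \<tau> s s'"
  shows "(sl_act_rep s g B, sl_act_rep s' g B') \<in> zipper i \<tau> s s'"
proof -
  have i: "1 \<le> i" "i < length s" "i < length s'" and ne: "s \<noteq> []" "s' \<noteq> []"
    using assms(1) by (auto simp: i_swapped_def)
  have len: "length s' = length s" using assms(1) by (rule i_swapped_length)
  note dm = i_swapped_dm[OF assms(1)]
  have g': "g \<in> SL (sum_list s')" using assms(2,3) by simp
  let ?N = "dm s (i - 1) + dm s (i + 1)" and ?D = "neighbour_act i s g"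
  have Z: "B \<in> X s" "surj_mat (in_mat i B)" "B' \<in> X s'"
    "\<forall>a<length s. a \<notin> {i - 1, i} \<longrightarrow> \<alpha> B a = \<alpha> B' a \<and> \<beta> B a = \<beta> B' a"
    "short_exact (out_mat i B') (in_mat i B)" "has_torsion (out_mat i B') (in_mat i B) \<tau>"
    "out_mat i B' * in_mat i B' = out_mat i B * in_mat i B + moment_scalar s B i \<cdot>\<^sub>m 1\<^sub>m ?N"
    using assms(4) by (auto simp: zipper_def surj_locus_def)
  have D: "?D \<in> SL ?N" by (rule neighbour_act_SL[OF assms(3) ne(1)])
  have D': "neighbour_act i s' g = ?D"
    by (simp only: neighbour_act_def len assms(2) dm)
  note B = X_cotangent[OF Z(1)] and B' = X_cotangent[OF Z(3)]
  note c = out_in_mat_carrier[OF B i(1,2)]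
  note c' = out_in_mat_carrier[OF B' i(1,3), unfolded dm]
  note e = out_in_mat_sl_act_rep[OF assms(3) B i(1,2)]
    out_in_mat_sl_act_rep[OF g' B' i(1,3), unfolded D']
  have "sl_act_rep s g B \<in> surj_locus i s"
    using sl_act_rep_X[OF assms(3) Z(1) ne(1)] surj_mat_mult_SL[OF D c(2) Z(2)]
    by (simp add: surj_locus_def e)
  moreover have "sl_act_rep s' g B' \<in> X s'" by (rule sl_act_rep_X[OF g' Z(3) ne(2)])
  moreover have "\<forall>a<length s. a \<notin> {i - 1, i} \<longrightarrow>
      \<alpha> (sl_act_rep s g B) a = \<alpha> (sl_act_rep s' g B') a \<and>
      \<beta> (sl_act_rep s g B) a = \<beta> (sl_act_rep s' g B') a"
    using Z(4) by (simp add: sl_act_rep_apply len)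
  ultimately show ?thesis
    using short_exact_mult_SL[OF D c'(1) c(2) Z(5)] has_torsion_mult_SL[OF D c'(1) c(2) Z(6)]
      conjugate_add_scalar[OF D c c' Z(7)]
    unfolding zipper_def mem_Collect_eq prod.case e moment_scalar_sl_act_rep[OF assms(3) B i(1,2)]
    by blast
qed

section \<open>Equivariance\<close>

text \<open>Comorphisms compose in the opposite order: that of \<open>g\<inverse> \<circ> \<Phi> \<circ> g\<close> first pulls back along
  \<open>g\<inverse>\<close> on the primed side, then applies the comorphism of \<open>\<Phi>\<close>, then pulls back along \<open>g\<close>.\<close>
lemma scheme_iso_conjugate:
  assumes "scheme_iso s s' \<Phi>" "g \<in> SL (sum_list s)" "g \<in> SL (sum_list s')" "s \<noteq> []" "s' \<noteq> []"
  shows "scheme_iso s s' (\<lambda>x\<in>M s. sl_act s' (minv g) (\<Phi> (sl_act s g x)))"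
proof -
  obtain h where h: "h \<in> ring_iso (inv_ring s') (inv_ring s)"
    "\<And>c. h (const_fun s' c) = const_fun s c"
    "\<Phi> = restrict (Spec_map (inv_ring s') h) (M s)"
    using assms(1) by (auto simp: scheme_iso_def)
  let ?k = "sl_pull s g \<circ> (h \<circ> sl_pull s' (minv g))"
  note m = SL_minv(5)[OF assms(3)]
  have "?k \<in> ring_iso (inv_ring s') (inv_ring s)"
    by (rule ring_iso_set_trans[OF ring_iso_set_trans[OF sl_pull_ring_iso[OF m assms(5)] h(1)]
          sl_pull_ring_iso[OF assms(2,4)]])
  moreover have "?k (const_fun s' c) = const_fun s c" for c
    by (simp add: sl_pull_const m assms h(2))
  moreover have "sl_act s' (minv g) (\<Phi> (sl_act s g x)) = Spec_map (inv_ring s') ?k x" if "x \<in> M s" for x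
  proof -
    have hc: "h r \<in> carrier (inv_ring s)" if "r \<in> carrier (inv_ring s')" for r
      by (rule bij_betw_apply[OF _ that]) (use h(1) in \<open>simp add: ring_iso_def\<close>)
    have "\<Phi> (sl_act s g x) = Spec_map (inv_ring s') h (sl_act s g x)"
      using sl_act_M[OF assms(2,4) that] by (simp add: h(3))
    then show ?thesis
      using sl_pull_carrier[OF m assms(5)] hc by (auto simp: sl_act_eq Spec_map_def)
  qed
  ultimately show ?thesis unfolding scheme_iso_def
    by (intro bexI[of _ ?k] conjI allI) (auto cong: restrict_cong)
qed

text \<open>The conjugate of \<open>\<Phi>\<close> by \<open>g\<close> has the two properties that characterise \<open>\<Phi>\<close>, so it is \<open>\<Phi>\<close>.\<close>
lemma unique_zipper_iso_equivariant:
  assumes "i_swapped i s s'" "sum_list s' = sum_list s" "is_unique_zipper_iso i \<tau> s s' \<Phi>"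
    "g \<in> SL (sum_list s)" "x \<in> M s"
  shows "\<Phi> (sl_act s g x) = sl_act s' g (\<Phi> x)"
proof -
  have ne: "s \<noteq> []" "s' \<noteq> []" using assms(1) by (auto simp: i_swapped_def)
  have g': "g \<in> SL (sum_list s')" using assms(2,4) by simp
  have iso: "scheme_iso s s' \<Phi>"
    and zip: "\<And>B B'. (B, B') \<in> zipper i \<tau> s s' \<Longrightarrow> \<Phi> (pt s B) = pt s' B'"
    and unique: "\<And>\<Psi>. zipper_iso i \<tau> s s' \<Psi> \<Longrightarrow> \<Psi> = \<Phi>"
    using assms(3) by (auto simp: is_unique_zipper_iso_def zipper_iso_def)
  let ?\<Psi> = "\<lambda>x\<in>M s. sl_act s' (minv g) (\<Phi> (sl_act s g x))"
  have "?\<Psi> (pt s B) = pt s' B'" if BB': "(B, B') \<in> zipper i \<tau> s s'" for B B'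
  proof -
    have X: "B \<in> X s" "B' \<in> X s'" using BB' by (auto simp: zipper_def surj_locus_def)
    have "?\<Psi> (pt s B) = sl_act s' (minv g) (\<Phi> (pt s (sl_act_rep s g B)))"
      using pt_in_M[OF X(1)] sl_act_pt[OF assms(4) ne(1) X(1)] by simp
    also have "\<dots> = sl_act s' (minv g) (pt s' (sl_act_rep s' g B'))"
      using zip[OF zipper_sl_act_rep[OF assms(1,2,4) BB']] by simp
    also have "\<dots> = pt s' (sl_act_rep s' (minv g) (sl_act_rep s' g B'))"
      by (rule sl_act_pt[OF SL_minv(5)[OF g'] ne(2) sl_act_rep_X[OF g' X(2) ne(2)]])
    also have "\<dots> = pt s' B'"
      using sl_act_rep_minv[OF g' X_cotangent[OF X(2)] ne(2)] by simp
    finally show ?thesis .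
  qed
  then have "?\<Psi> = \<Phi>"
    using scheme_iso_conjugate[OF iso assms(4) g' ne]
    by (intro unique) (auto simp: zipper_iso_def)
  then have "sl_act s' (minv g) (\<Phi> (sl_act s g x)) = \<Phi> x"
    using assms(5) by (metis restrict_apply')
  moreover have "\<Phi> (sl_act s g x) \<in> M s'"
    using scheme_iso_bij[OF iso] sl_act_M[OF assms(4) ne(1) assms(5)] by (auto simp: bij_betw_def)
  ultimately show ?thesis using sl_act_minv[OF g' ne(2)] by metis
qed

theorem proposition2p19:
  fixes n i :: nat and s s' :: "nat list" and \<tau> :: complex
    and \<Phi> :: "(rep \<Rightarrow> complex) set \<Rightarrow> (rep \<Rightarrow> complex) set"
  assumes "standard_parabolic n s" and "standard_parabolic n s'"
    and "i_swapped i s s'"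
    and "\<tau> \<noteq> 0"
    and "is_reflection_functor i \<tau> s s' \<Phi>"
  shows "\<forall>g\<in>SL n. \<forall>x\<in>M s. \<Phi> (sl_act s g x) = sl_act s' g (\<Phi> x)"
proof (intro ballI)
  fix g x assume g: "g \<in> SL n" and x: "x \<in> M s"
  have n: "sum_list s = n" "sum_list s' = n"
    using assms(1,2) by (simp_all add: standard_parabolic_def)
  show "\<Phi> (sl_act s g x) = sl_act s' g (\<Phi> x)"
  proof (cases "s ! (i - 1) \<le> s ! i")
    case True
    then show ?thesis
      using assms(5) g x n
      by (intro unique_zipper_iso_equivariant[OF assms(3)]) (auto simp: is_reflection_functor_def)
  next
    case False
    \<comment> \<open>\<open>\<Phi>\<close> is the inverse of \<open>\<Psi>\<close>; write \<open>x\<close> as \<open>\<Psi> y\<close> and use that \<open>\<Psi>\<close> is equivariant\<close>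
    then obtain \<Psi> where \<Psi>: "is_unique_zipper_iso i \<tau> s' s \<Psi>"
      and \<Phi>: "\<Phi> = restrict (inv_into (M s') \<Psi>) (M s)"
      using assms(5) by (auto simp: is_reflection_functor_def)
    have "bij_betw \<Psi> (M s') (M s)"
      using \<Psi> by (intro scheme_iso_bij) (simp add: is_unique_zipper_iso_def zipper_iso_def)
    then have inj: "inj_on \<Psi> (M s')" and img: "\<Psi> ` M s' = M s" by (auto simp: bij_betw_def)
    have \<Phi>\<Psi>: "\<Phi> (\<Psi> z) = z" if "z \<in> M s'" for z
      using that img inj by (auto simp: \<Phi>)
    obtain y where y: "y \<in> M s'" "x = \<Psi> y" using x img by blast
    have "s' \<noteq> []" using assms(3) by (auto simp: i_swapped_def)
    then have gy: "sl_act s' g y \<in> M s'" using sl_act_M[of g s' y] g n y by simp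
    have "\<Psi> (sl_act s' g y) = sl_act s g (\<Psi> y)"
      using unique_zipper_iso_equivariant[OF i_swapped_sym[OF assms(3)] _ \<Psi>, of g y] g y n by simp
    then show ?thesis using \<Phi>\<Psi>[OF gy] \<Phi>\<Psi>[OF y(1)] y(2) by metis
  qed
qed

end
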